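(* Let $\mathcal C$ be a shock manifold and suppose the uniform Lopatinski condition holds at $q\in\mathcal C$; let $\chi$ be any local defining function for $\mathcal C$ near $q$. Then: (a) $\chi'_{p,s}(q)$ has full rank $N+k$; (b) if $d\ge2$, $\chi'_p(q)$ has full rank $N+k$.
   Context: $A_0,\dots,A_d$ are $C^\infty$ maps from a connected open set $\mathcal U^*\subset\mathbb R^N$ to $\mathbb R^{N\times N}$ with $A_0(u)$ invertible; $\mathcal U_\pm\subset\mathcal U^*$ are connected open sets such that for $u\in\mathcal U_+\cup\mathcal U_-$ and $\xi\in\mathbb R^d\setminus\{0\}$ the eigenvalues of $\sum_{j=1}^d\xi_jA_0(u)^{-1}A_j(u)$ are real. For $(s,h)\in\mathbb R\times\mathbb R^{d-1}$, $\mathcal A_d(u,s,h)=A_d(u)-sA_0(u)-\sum_{j=1}^{d-1}h_jA_j(u)$. Shock manifold: for an integer $0\le k\le N+1$, $\mathcal C\subset\mathcal U_+\times\mathcal U_-\times\mathbb R^d$ is a connected $C^\infty$ submanifold of dimension $N+d-k$ such that for all $q=(p_+,p_-,s,h)\in\mathcal C$ the matrices $\mathcal A_d(p_\pm,s,h)$ are invertible, and $R_-+L_+=N+1-k$, where $R_-$ is the number of negative eigenvalues of $A_0(p_+)^{-1}\mathcal A_d(p_+,s,h)$ and $L_+$ the number of positive eigenvalues of $A_0(p_-)^{-1}\mathcal A_d(p_-,s,h)$. A local defining function near $q$ is a $C^\infty$ map $\chi:\mathcal O\to\mathbb R^{N+k}$ on an open neighborhood $\mathcal O\subset\mathbb R^{2N+d}$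 of $q$ with $\nabla\chi(q)$ of full rank $N+k$ and $\mathcal C\cap\mathcal O=\{\chi=0\}$. Write $p=(p_+,p_-)$; $\chi'_p,\chi'_s,\chi'_h$ are partial derivatives and $\chi'_{p,s}$ is the derivative with respect to $(p,s)$. Uniform Lopatinski condition: let $S^d_+=\{\hat\zeta=(\hat\tau,\hat\gamma,\hat\eta)\in\mathbb R\times\mathbb R\times\mathbb R^{d-1}:|\hat\zeta|=1,\hat\gamma>0\}$, $$H_{0\pm}(q,\hat\zeta)=-\mathcal A_d(p_\pm,s,h)^{-1}\Big(A_0(p_\pm)(i\hat\tau+\hat\gamma)+\sum_{j=1}^{d-1}A_j(p_\pm)i\hat\eta_j\Big),$$ and $\mathbb E_-(H_0(q,\hat\zeta))=\mathbb E_-(H_{0+})\times\mathbb E_+(H_{0-})\subset\mathbb C^{2N}$, where $\mathbb E_\pm(M)$ is the sum of generalized eigenspaces of $M$ for eigenvalues with $\pm\mathrm{Re}\,\mu>0$; this space has dimension $N+k-1$. Set $$D_{Lop}(q,\hat\zeta)=\det\big(\chi'_p(q)\mathbb E_-(H_0(q,\hat\zeta)),\ \chi'_s(q)(i\hat\tau+\hat\gamma)+\chi'_h(q)i\hat\eta\big),$$ an $(N+k)\times(N+k)$ determinant whose first $N+k-1$ columns are computed with an orthonormal basis of $\mathbb E_-(H_0)$. The condition holds at $q$ if there is $c>0$ with $|D_{Lop}(q,\hat\zeta)|\ge c$ for all $\hat\zeta\in S^d_+$ (this is independent of the choice of $\chi$). *)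

theory Defs
  imports "HOL-Analysis.Analysis" "HOL-Computational_Algebra.Polynomial"
begin

section \<open>Smooth maps and submanifolds\<close>

text \<open>All derivatives are full Frechet derivatives, so these notions are only meant for open \<open>S\<close>.\<close>

primrec higher_differentiable_on ::
  "'a::real_normed_vector set \<Rightarrow> ('a \<Rightarrow> 'b::real_normed_vector) \<Rightarrow> nat \<Rightarrow> bool" where
  "higher_differentiable_on S f 0 \<longleftrightarrow> continuous_on S f"
| "higher_differentiable_on S f (Suc n) \<longleftrightarrow>
     (\<forall>x\<in>S. f differentiable (at x)) \<and>
     (\<forall>v. higher_differentiable_on S (\<lambda>x. frechet_derivative f (at x) v) n)"

definition smooth_on ::
  "'a::real_normed_vector set \<Rightarrow> ('a \<Rightarrow> 'b::real_normed_vector) \<Rightarrow> bool" where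
  "smooth_on S f \<longleftrightarrow> (\<forall>n. higher_differentiable_on S f n)"

definition smooth_submanifold :: "nat \<Rightarrow> 'a::euclidean_space set \<Rightarrow> bool" where
  "smooth_submanifold m M \<longleftrightarrow>
     (\<forall>x\<in>M. \<exists>U V \<phi> \<psi> W. open U \<and> x \<in> U \<and> open V \<and>
        homeomorphism U V \<phi> \<psi> \<and> smooth_on U \<phi> \<and> smooth_on V (\<psi> :: 'a \<Rightarrow> 'a) \<and>
        subspace W \<and> dim W = m \<and> \<phi> ` (M \<inter> U) = V \<inter> W)"


section \<open>Eigenvalues of matrices\<close>

definition charpoly :: "'a::field^'n^'n \<Rightarrow> 'a poly" where
  "charpoly M = det (\<chi> i j. (if i = j then [:0, 1:] else 0) - [:M $ i $ j:])"

text \<open>Numbers of negative and positive (real) eigenvalues, with algebraic multiplicity.\<close>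

definition num_neg_eigenvalues :: "real^'n^'n \<Rightarrow> nat" where
  "num_neg_eigenvalues M = size {# \<mu> \<in># proots (charpoly M). \<mu> < 0 #}"

definition num_pos_eigenvalues :: "real^'n^'n \<Rightarrow> nat" where
  "num_pos_eigenvalues M = size {# \<mu> \<in># proots (charpoly M). \<mu> > 0 #}"

definition eigenvalue_of :: "complex^'n^'n \<Rightarrow> complex \<Rightarrow> bool" where
  "eigenvalue_of M \<mu> \<longleftrightarrow> (\<exists>v. v \<noteq> 0 \<and> M *v v = \<mu> *s v)"

definition gen_eigenspace :: "complex^'n^'n \<Rightarrow> complex \<Rightarrow> (complex^'n) set" where
  "gen_eigenspace M \<mu> = {v. \<exists>m. ((\<lambda>w. M *v w - \<mu> *s w) ^^ m) v = 0}"

text \<open>Here \<open>vec.span\<close> is the complex span; the plain \<open>span\<close> would be the real one.\<close>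

definition E_minus :: "complex^'n^'n \<Rightarrow> (complex^'n) set" where
  "E_minus M = vec.span (\<Union>\<mu>\<in>{\<mu>. eigenvalue_of M \<mu> \<and> Re \<mu> < 0}. gen_eigenspace M \<mu>)"

definition E_plus :: "complex^'n^'n \<Rightarrow> (complex^'n) set" where
  "E_plus M = vec.span (\<Union>\<mu>\<in>{\<mu>. eigenvalue_of M \<mu> \<and> Re \<mu> > 0}. gen_eigenspace M \<mu>)"

abbreviation cmat :: "real^'n^'m \<Rightarrow> complex^'n^'m" where
  "cmat \<equiv> map_matrix complex_of_real"


section \<open>The system of conservation laws\<close>

text \<open>
  The space directions \<open>1, \<dots>, d\<close> are the elements of a finite type \<open>'d\<close>, and \<open>d :: 'd\<close> is the
  distinguished (last) one; the number of directions is \<open>CARD('d)\<close>. This way the case of one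
  space dimension is included, which a type for the vectors with \<open>CARD('d) - 1\<close> components
  would exclude. A pair \<open>(s,h)\<close> is a single vector \<open>\<sigma> :: real^'d\<close> with \<open>s = \<sigma> $ d\<close> and
  \<open>h\<^sub>j = \<sigma> $ j\<close> for \<open>j \<noteq> d\<close>. Likewise \<open>(\<tau>,\<eta>)\<close> is a vector \<open>y :: real^'d\<close> with
  \<open>\<tau> = y $ d\<close> and \<open>\<eta>\<^sub>j = y $ j\<close> for \<open>j \<noteq> d\<close>.
\<close>

type_synonym ('n, 'd) front_point = "(real^'n) \<times> (real^'n) \<times> (real^'d)"

definition hyperbolic_system ::
  "(real^'n) set \<Rightarrow> (real^'n) set \<Rightarrow> (real^'n) set \<Rightarrow>
   (real^'n \<Rightarrow> real^'n^'n) \<Rightarrow> ('d::finite \<Rightarrow> real^'n \<Rightarrow> real^'n^'n) \<Rightarrow> bool" where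
  "hyperbolic_system Us Up Um A0 A \<longleftrightarrow>
     open Us \<and> connected Us \<and>
     smooth_on Us A0 \<and> (\<forall>j. smooth_on Us (A j)) \<and> (\<forall>u\<in>Us. invertible (A0 u)) \<and>
     Up \<subseteq> Us \<and> open Up \<and> connected Up \<and> Um \<subseteq> Us \<and> open Um \<and> connected Um \<and>
     (\<forall>u\<in>Up \<union> Um. \<forall>\<xi>::real^'d. \<xi> \<noteq> 0 \<longrightarrow>
        (\<forall>\<mu>. eigenvalue_of (cmat (\<Sum>j\<in>UNIV. \<xi> $ j *\<^sub>R (matrix_inv (A0 u) ** A j u))) \<mu> \<longrightarrow> \<mu> \<in> \<real>))"

definition front_matrix ::
  "(real^'n \<Rightarrow> real^'n^'n) \<Rightarrow> ('d::finite \<Rightarrow> real^'n \<Rightarrow> real^'n^'n) \<Rightarrow> 'd \<Rightarrow>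
   real^'n \<Rightarrow> real^'d \<Rightarrow> real^'n^'n" where
  "front_matrix A0 A d u \<sigma> = A d u - \<sigma> $ d *\<^sub>R A0 u - (\<Sum>j\<in>UNIV - {d}. \<sigma> $ j *\<^sub>R A j u)"


section \<open>Shock manifolds\<close>

definition shock_manifold ::
  "(real^'n \<Rightarrow> real^'n^'n) \<Rightarrow> ('d::finite \<Rightarrow> real^'n \<Rightarrow> real^'n^'n) \<Rightarrow> 'd \<Rightarrow>
   (real^'n) set \<Rightarrow> (real^'n) set \<Rightarrow> nat \<Rightarrow> ('n::finite, 'd::finite) front_point set \<Rightarrow> bool" where
  "shock_manifold A0 A d Up Um k C \<longleftrightarrow>
     k \<le> CARD('n) + 1 \<and>
     C \<subseteq> Up \<times> Um \<times> UNIV \<and> connected C \<and> smooth_submanifold (CARD('n) + CARD('d) - k) C \<and>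
     (\<forall>(pp, pm, \<sigma>)\<in>C.
        invertible (front_matrix A0 A d pp \<sigma>) \<and> invertible (front_matrix A0 A d pm \<sigma>) \<and>
        num_neg_eigenvalues (matrix_inv (A0 pp) ** front_matrix A0 A d pp \<sigma>) +
        num_pos_eigenvalues (matrix_inv (A0 pm) ** front_matrix A0 A d pm \<sigma>) = CARD('n) + 1 - k)"

text \<open>In the intended use \<open>CARD('m)\<close> is the codimension \<open>N + k\<close> of \<open>C\<close>.\<close>

definition local_defining_function ::
  "'a::euclidean_space set \<Rightarrow> 'a \<Rightarrow> ('a \<Rightarrow> real^'m) \<Rightarrow> bool" where
  "local_defining_function C q chi \<longleftrightarrow>
     (\<exists>U. open U \<and> q \<in> U \<and> smooth_on U chi \<and>
        dim (range (frechet_derivative chi (at q))) = CARD('m) \<and>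
        C \<inter> U = {x \<in> U. chi x = 0})"

text \<open>Partial derivatives with respect to \<open>p = (p\<^sub>+, p\<^sub>-)\<close>, to \<open>(p,s)\<close>, and to \<open>\<sigma> $ j\<close>;
  the last is the derivative in \<open>s\<close> for \<open>j = d\<close> and in \<open>h\<^sub>j\<close> otherwise.\<close>

definition deriv_p ::
  "(('n::finite, 'd::finite) front_point \<Rightarrow> real^'m) \<Rightarrow> ('n::finite, 'd::finite) front_point \<Rightarrow>
   (real^'n) \<times> (real^'n) \<Rightarrow> real^'m" where
  "deriv_p chi q = (\<lambda>(vp, vm). frechet_derivative chi (at q) (vp, vm, 0))"

definition deriv_ps ::
  "'d::finite \<Rightarrow> (('n::finite, 'd::finite) front_point \<Rightarrow> real^'m) \<Rightarrow> ('n::finite, 'd::finite) front_point \<Rightarrow>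
   (real^'n) \<times> (real^'n) \<times> real \<Rightarrow> real^'m" where
  "deriv_ps d chi q = (\<lambda>(vp, vm, t). frechet_derivative chi (at q) (vp, vm, axis d t))"

definition deriv_sh ::
  "(('n::finite, 'd::finite) front_point \<Rightarrow> real^'m) \<Rightarrow> ('n::finite, 'd::finite) front_point \<Rightarrow> 'd::finite \<Rightarrow> real^'m" where
  "deriv_sh chi q j = frechet_derivative chi (at q) (0, 0, axis j 1)"


section \<open>The uniform Lopatinski condition\<close>

definition S_plus :: "((real^'d) \<times> real) set" where
  "S_plus = {(y, \<gamma>). norm (y, \<gamma>) = 1 \<and> \<gamma> > 0}"

definition H0 ::
  "(real^'n \<Rightarrow> real^'n^'n) \<Rightarrow> ('d::finite \<Rightarrow> real^'n \<Rightarrow> real^'n^'n) \<Rightarrow> 'd \<Rightarrow>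
   real^'n \<Rightarrow> real^'d \<Rightarrow> (real^'d) \<times> real \<Rightarrow> complex^'n^'n" where
  "H0 A0 A d u \<sigma> = (\<lambda>(y, \<gamma>).
     - (cmat (matrix_inv (front_matrix A0 A d u \<sigma>)) **
        (\<chi> a b. of_real (A0 u $ a $ b) * (\<i> * of_real (y $ d) + of_real \<gamma>) +
           (\<Sum>j\<in>UNIV - {d}. of_real (A j u $ a $ b) * \<i> * of_real (y $ j)))))"

definition E_minus_H0 ::
  "(real^'n \<Rightarrow> real^'n^'n) \<Rightarrow> ('d::finite \<Rightarrow> real^'n \<Rightarrow> real^'n^'n) \<Rightarrow> 'd \<Rightarrow>
   ('n::finite, 'd::finite) front_point \<Rightarrow> (real^'d) \<times> real \<Rightarrow> ((complex^'n) \<times> (complex^'n)) set" where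
  "E_minus_H0 A0 A d = (\<lambda>(pp, pm, \<sigma>) \<zeta>.
     E_minus (H0 A0 A d pp \<sigma> \<zeta>) \<times> E_plus (H0 A0 A d pm \<sigma> \<zeta>))"

text \<open>\<open>b\<close>, restricted to \<open>J\<close>, is an orthonormal basis of the complex subspace \<open>E\<close>, with respect to the
  standard Hermitian product (the library's \<open>inner\<close> on \<open>complex^'n\<close> is only its real part).\<close>

definition hermitian_prod :: "(complex^'n) \<times> (complex^'n) \<Rightarrow> (complex^'n) \<times> (complex^'n) \<Rightarrow> complex" where
  "hermitian_prod v w =
     (\<Sum>i\<in>UNIV. fst v $ i * cnj (fst w $ i)) + (\<Sum>i\<in>UNIV. snd v $ i * cnj (snd w $ i))"

definition orthonormal_basis_on ::
  "'j set \<Rightarrow> ('j \<Rightarrow> (complex^'n) \<times> (complex^'n)) \<Rightarrow> ((complex^'n) \<times> (complex^'n)) set \<Rightarrow> bool" where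
  "orthonormal_basis_on J b E \<longleftrightarrow>
     (\<forall>i\<in>J. \<forall>j\<in>J. hermitian_prod (b i) (b j) = (if i = j then 1 else 0)) \<and>
     E = range (\<lambda>c. \<Sum>j\<in>J. (c j *s fst (b j), c j *s snd (b j)))"

text \<open>Complex-linear extension of a real-linear map.\<close>

definition complexify ::
  "((real^'n) \<times> (real^'n) \<Rightarrow> real^'m) \<Rightarrow> (complex^'n) \<times> (complex^'n) \<Rightarrow> complex^'m" where
  "complexify L = (\<lambda>(v, w). \<chi> r.
     Complex (L (\<chi> i. Re (v $ i), \<chi> i. Re (w $ i)) $ r) (L (\<chi> i. Im (v $ i), \<chi> i. Im (w $ i)) $ r))"

text \<open>The column \<open>l\<close> is the one coming from the front; the others are enumerated by \<open>b\<close>.\<close>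

definition lopatinski_det ::
  "'d::finite \<Rightarrow> (('n::finite, 'd::finite) front_point \<Rightarrow> real^'m) \<Rightarrow> ('n::finite, 'd::finite) front_point \<Rightarrow>
   (real^'d) \<times> real \<Rightarrow> 'm \<Rightarrow> ('m \<Rightarrow> (complex^'n) \<times> (complex^'n)) \<Rightarrow> complex" where
  "lopatinski_det d chi q = (\<lambda>(y, \<gamma>) l b.
     det (\<chi> r c. if c = l
       then of_real (deriv_sh chi q d $ r) * (\<i> * of_real (y $ d) + of_real \<gamma>) +
            (\<Sum>j\<in>UNIV - {d}. of_real (deriv_sh chi q j $ r) * \<i> * of_real (y $ j))
       else complexify (deriv_p chi q) (b c) $ r))"

text \<open>The choice of \<open>l\<close> and \<open>b\<close> changes the determinant only by a factor of modulus one. On a shock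
  manifold with \<open>CARD('m) = N + k\<close> the space has dimension \<open>N + k - 1\<close>, so a basis indexed by
  \<open>UNIV - {l}\<close> exists.\<close>

definition uniform_lopatinski ::
  "(real^'n \<Rightarrow> real^'n^'n) \<Rightarrow> ('d::finite \<Rightarrow> real^'n \<Rightarrow> real^'n^'n) \<Rightarrow> 'd \<Rightarrow>
   (('n::finite, 'd::finite) front_point \<Rightarrow> real^'m) \<Rightarrow> ('n::finite, 'd::finite) front_point \<Rightarrow> bool" where
  "uniform_lopatinski A0 A d chi q \<longleftrightarrow>
     (\<exists>c>0. \<forall>\<zeta>\<in>S_plus. \<exists>l b.
        orthonormal_basis_on (UNIV - {l}) b (E_minus_H0 A0 A d q \<zeta>) \<and>
        cmod (lopatinski_det d chi q \<zeta> l b) \<ge> c)"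

end

theory Submission
  imports Defs
begin

text \<open>
  Suppose the range of \<open>\<chi>'\<^sub>p(q)\<close> is not everything, and let \<open>\<nu>\<close> be a nonzero real vector orthogonal to
  it. Multiplying the Lopatinski matrix by \<open>\<nu>\<close> from the left kills all columns coming from
  \<open>E\<^sub>-(H\<^sub>0)\<close> and leaves in the front column the scalar
  \<open>\<nu>\<cdot>\<chi>'\<^sub>s (i\<tau> + \<gamma>) + i \<nu>\<cdot>\<chi>'\<^sub>h \<eta>\<close>. Since the entries of the matrix are bounded uniformly in the
  frequency (the basis is orthonormal), Cramer's rule bounds the determinant by a constant times
  this scalar. Hence the uniform Lopatinski condition bounds the scalar away from zero
  (\<open>uniform_lopatinski_front_symbol_lower_bound\<close>).

  If \<open>\<nu>\<close> is orthogonal to the range of \<open>\<chi>'\<^bsub>p,s\<^esub>(q)\<close>, then \<open>\<nu>\<cdot>\<chi>'\<^sub>s = 0\<close> and the scalar vanishes at the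
  frequency \<open>\<tau> = 0\<close>, \<open>\<eta> = 0\<close>, \<open>\<gamma> = 1\<close>: this excludes such a \<open>\<nu>\<close> and gives the first claim. If \<open>\<nu>\<close> is
  only orthogonal to the range of \<open>\<chi>'\<^sub>p(q)\<close>, the first claim shows \<open>\<nu>\<cdot>\<chi>'\<^sub>s \<noteq> 0\<close>. In at least two
  space dimensions there is some \<open>\<eta> \<noteq> 0\<close>, and \<open>\<tau>\<close> can be chosen with
  \<open>\<nu>\<cdot>\<chi>'\<^sub>s \<tau> + \<nu>\<cdot>\<chi>'\<^sub>h \<eta> = 0\<close>. Then the scalar is \<open>\<nu>\<cdot>\<chi>'\<^sub>s \<gamma>\<close>, which tends to zero with \<open>\<gamma>\<close> while
  \<open>\<eta> \<noteq> 0\<close> keeps the frequency away from the origin, so that normalizing it to the sphere does no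
  harm: a contradiction.

  Finally, the Lopatinski condition is given for one defining function and the claim is about
  another. Both derivatives at \<open>q\<close> are surjective and have the same kernel, the tangent space of the
  manifold (\<open>kernel_of_local_defining_function_unique\<close>), so surjectivity of a restriction
  passes from one to the other.
\<close>


section \<open>Derivatives of local defining functions\<close>

lemma smooth_on_imp_differentiable:
  assumes "smooth_on U f" "x \<in> U"
  shows "f differentiable (at x)"
proof -
  have "higher_differentiable_on U f (Suc 0)"
    using assms(1) unfolding smooth_on_def by blast
  with assms(2) show ?thesis by simp
qed

lemma smooth_on_imp_continuous_on_derivative:
  assumes "smooth_on U f"
  shows "continuous_on U (\<lambda>x. frechet_derivative f (at x) v)"
proof -
  have "higher_differentiable_on U f (Suc 0)"
    using assms unfolding smooth_on_def by blast
  then show ?thesis by simp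
qed

text \<open>
  With a right inverse \<open>R\<close> of the surjective derivative \<open>D q\<close>, the map
  \<open>G x = x + R (f x - D q (x - q))\<close> has the identity as its derivative at \<open>q\<close> and satisfies
  \<open>D q (G x - q) = f x\<close>. So \<open>G\<close> is a local change of coordinates that straightens the level set of
  \<open>f\<close> to an affine subspace, and the curve is a straight line in these coordinates.
\<close>

lemma kernel_vector_tangent_to_level_set:
  fixes f :: "'a::euclidean_space \<Rightarrow> 'b::euclidean_space"
  assumes "open U" "q \<in> U" and smooth: "smooth_on U f" and fq: "f q = 0"
    and surj: "range (frechet_derivative f (at q)) = UNIV"
    and v: "frechet_derivative f (at q) v = 0"
  obtains \<gamma> e where "e > 0" "\<gamma> 0 = q" "(\<gamma> has_derivative (\<lambda>t. t *\<^sub>R v)) (at (0::real))"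
    "\<And>t. \<bar>t\<bar> < e \<Longrightarrow> \<gamma> t \<in> U \<and> f (\<gamma> t) = 0"
proof -
  define D where "D = (\<lambda>x. frechet_derivative f (at x))"
  have derf: "(f has_derivative D x) (at x)" if "x \<in> U" for x
    using smooth_on_imp_differentiable[OF smooth that] unfolding D_def
    by (simp add: frechet_derivative_works)
  have linD: "linear (D q)"
    using derf[OF \<open>q \<in> U\<close>] has_derivative_linear by blast
  obtain R where R: "linear R" "D q \<circ> R = id"
    using linear_surjective_right_inverse[OF linD] surj by (auto simp: D_def)
  define G where "G = (\<lambda>x. x + R (f x - D q (x - q)))"
  define G' where "G' = (\<lambda>x. Blinfun (\<lambda>h. h + R (D x h - D q h)))"
  have blR: "bounded_linear R" and blDq: "bounded_linear (D q)"
    using R(1) linD by (simp_all add: linear_conv_bounded_linear)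
  have derG: "(G has_derivative (\<lambda>h. h + R (D x h - D q h))) (at x)" if "x \<in> U" for x
    unfolding G_def
    by (rule derivative_eq_intros derf[OF that] bounded_linear.has_derivative[OF blR]
        bounded_linear.has_derivative[OF blDq] refl | simp)+
  have G'_apply: "blinfun_apply (G' x) = (\<lambda>h. h + R (D x h - D q h))" if "x \<in> U" for x
    unfolding G'_def using derG[OF that]
    by (simp add: bounded_linear_Blinfun_apply has_derivative_bounded_linear)
  have contG': "continuous_on U G'"
  proof (rule continuous_on_blinfun_componentwise)
    fix i :: 'a
    have "continuous_on U (\<lambda>x. i + R (D x i - D q i))"
      unfolding D_def
      by (intro continuous_intros linear_continuous_on_compose[OF _ R(1)]
          smooth_on_imp_continuous_on_derivative[OF smooth])
    then show "continuous_on U (\<lambda>x. blinfun_apply (G' x) i)"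
      by (rule continuous_on_eq) (simp add: G'_apply)
  qed
  have G'q: "G' q = id_blinfun"
    by (rule blinfun_eqI) (simp add: G'_apply[OF \<open>q \<in> U\<close>] linear_0[OF R(1)])
  obtain U' V g g' where loc: "open U'" "U' \<subseteq> U" "q \<in> U'" "open V" "G q \<in> V" "homeomorphism U' V G g"
    "\<And>y. y \<in> V \<Longrightarrow> (g has_derivative g' y) (at y)"
    "\<And>y. y \<in> V \<Longrightarrow> g' y = inv (blinfun_apply (G' (g y)))"
  proof (rule inverse_function_theorem[OF \<open>open U\<close> _ contG' \<open>q \<in> U\<close>, of G id_blinfun])
    show "(G has_derivative blinfun_apply (G' x)) (at x)" if "x \<in> U" for x
      using derG[OF that] by (simp add: G'_apply[OF that])
    show "id_blinfun o\<^sub>L G' q = id_blinfun"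
      by (rule blinfun_eqI) (simp add: G'q)
  qed blast
  have Gq: "G q = q"
    by (simp add: G_def fq linear_0[OF linD] linear_0[OF R(1)])
  have gq: "g q = q"
    using loc(3,6) Gq by (metis homeomorphism_def)
  have dg: "(g has_derivative (\<lambda>h. h)) (at q)"
    using loc(7)[of q] loc(8)[of q] loc(5) Gq gq G'q by (simp add: inv_id[unfolded id_def])
  define \<gamma> where "\<gamma> = (\<lambda>t::real. g (q + t *\<^sub>R v))"
  obtain r where r: "r > 0" "ball q r \<subseteq> V"
    using loc(4,5) Gq openE by metis
  define e where "e = r / (norm v + 1)"
  have "e > 0" using r by (simp add: e_def add_nonneg_pos)
  show ?thesis
  proof
    show "e > 0" by fact
    show "\<gamma> 0 = q" by (simp add: \<gamma>_def gq)
    have 1: "((\<lambda>t::real. q + t *\<^sub>R v) has_derivative (\<lambda>t. t *\<^sub>R v)) (at 0)"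
      by (auto intro!: derivative_eq_intros)
    show "(\<gamma> has_derivative (\<lambda>t. t *\<^sub>R v)) (at 0)"
      unfolding \<gamma>_def using has_derivative_compose[OF 1, of g "\<lambda>h. h"] dg by simp
  next
    fix t :: real assume t: "\<bar>t\<bar> < e"
    have "\<bar>t\<bar> * norm v \<le> \<bar>t\<bar> * (norm v + 1)" by (simp add: mult_left_mono)
    also have "\<dots> < r" using t by (simp add: e_def add_nonneg_pos pos_less_divide_eq)
    finally have inV: "q + t *\<^sub>R v \<in> V" using r(2) by (auto simp: dist_norm subset_iff)
    then have gU: "\<gamma> t \<in> U" and GG: "G (\<gamma> t) = q + t *\<^sub>R v"
      using loc(2,6) unfolding \<gamma>_def homeomorphism_def by auto
    have "D q (G x - q) = f x" for x
    proof -
      have "D q (R y) = y" for y using R(2) by (metis comp_apply id_apply)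
      then show ?thesis
        by (simp add: G_def linear_add[OF linD] linear_diff[OF linD])
    qed
    then have "f (\<gamma> t) = D q (t *\<^sub>R v)" by (metis GG add_diff_cancel_left')
    also have "\<dots> = 0" using v linear_cmul[OF linD, of t v] by (simp add: D_def)
    finally show "\<gamma> t \<in> U \<and> f (\<gamma> t) = 0" using gU by blast
  qed
qed

lemma has_derivative_along_curve_in_zero_set:
  fixes \<gamma> :: "real \<Rightarrow> 'a::real_normed_vector" and f :: "'a \<Rightarrow> 'b::real_normed_vector"
  assumes "(\<gamma> has_derivative (\<lambda>t. t *\<^sub>R v)) (at 0)" "(f has_derivative D) (at (\<gamma> 0))"
    and "\<forall>\<^sub>F t in nhds 0. f (\<gamma> t) = 0"
  shows "D v = 0"
proof -
  have 1: "((\<lambda>t. f (\<gamma> t)) has_derivative (\<lambda>t. D (t *\<^sub>R v))) (at 0)"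
    using has_derivative_compose[OF assms(1,2)] .
  obtain S where S: "open S" "0 \<in> S" "\<And>t. t \<in> S \<Longrightarrow> f (\<gamma> t) = 0"
    using assms(3) unfolding eventually_nhds by blast
  have "((\<lambda>t. f (\<gamma> t)) has_derivative (\<lambda>t. 0)) (at 0)"
    by (rule has_derivative_transform_within_open[OF has_derivative_const S(1,2)]) (simp add: S(3))
  then have "(\<lambda>t. D (t *\<^sub>R v)) = (\<lambda>t. 0)"
    using has_derivative_unique[OF 1] by blast
  then have "D (1 *\<^sub>R v) = 0" by metis
  then show ?thesis by simp
qed

lemma range_frechet_derivative_eq_UNIV:
  assumes "local_defining_function C q (chi :: _ \<Rightarrow> real^'m)"
  shows "range (frechet_derivative chi (at q)) = UNIV"
proof -
  have "chi differentiable (at q)" "dim (range (frechet_derivative chi (at q))) = CARD('m)"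
    using assms smooth_on_imp_differentiable unfolding local_defining_function_def by blast+
  then show ?thesis
    by (metis DIM_cart DIM_real dim_eq_full linear_frechet_derivative linear_subspace_image
        mult.right_neutral span_eq_iff subspace_UNIV)
qed

text \<open>
  A kernel vector of one derivative is the velocity of a curve that stays in the common zero set
  \<open>C\<close>, and differentiating the other function along this curve gives zero.
\<close>

lemma kernel_of_local_defining_function_unique:
  fixes chi0 :: "'a::euclidean_space \<Rightarrow> real^'m" and chi :: "'a \<Rightarrow> real^'l"
  assumes chi0: "local_defining_function C q chi0" and chi: "local_defining_function C q chi"
    and "q \<in> C" and v: "frechet_derivative chi0 (at q) v = 0"
  shows "frechet_derivative chi (at q) v = 0"
proof -
  obtain U0 where U0: "open U0" "q \<in> U0" "smooth_on U0 chi0" "C \<inter> U0 = {x \<in> U0. chi0 x = 0}"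
    using chi0 unfolding local_defining_function_def by blast
  obtain U where U: "open U" "q \<in> U" "smooth_on U chi" "C \<inter> U = {x \<in> U. chi x = 0}"
    using chi unfolding local_defining_function_def by blast
  have "chi0 q = 0" using U0(2,4) \<open>q \<in> C\<close> by blast
  then obtain \<gamma> e where \<gamma>: "e > 0" "\<gamma> 0 = q" "(\<gamma> has_derivative (\<lambda>t. t *\<^sub>R v)) (at (0::real))"
    "\<And>t. \<bar>t\<bar> < e \<Longrightarrow> \<gamma> t \<in> U0 \<and> chi0 (\<gamma> t) = 0"
    using kernel_vector_tangent_to_level_set
      [OF U0(1-3) _ range_frechet_derivative_eq_UNIV[OF chi0] v] by metis
  have "isCont \<gamma> 0" using \<gamma>(3) has_derivative_continuous by blast
  then have "\<forall>\<^sub>F t in nhds 0. \<gamma> t \<in> U"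
    unfolding continuous_at_open eventually_nhds using U(1,2) \<gamma>(2) by simp
  moreover have "\<forall>\<^sub>F t in nhds (0::real). \<bar>t\<bar> < e"
    using \<gamma>(1) by (auto simp: eventually_nhds_metric dist_real_def)
  ultimately have "\<forall>\<^sub>F t in nhds 0. chi (\<gamma> t) = 0"
  proof eventually_elim
    case (elim t)
    then have "\<gamma> t \<in> C \<inter> U" using \<gamma>(4) U0(4) by blast
    then show ?case using U(4) by blast
  qed
  moreover have "(chi has_derivative frechet_derivative chi (at q)) (at (\<gamma> 0))"
    using smooth_on_imp_differentiable[OF U(3,2)] \<gamma>(2) by (simp add: frechet_derivative_works)
  ultimately show ?thesis
    using has_derivative_along_curve_in_zero_set[OF \<gamma>(3)] by blast
qed

text \<open>
  \<open>D\<close> factors through \<open>D0\<close> by a surjective map, which sends the range of a restriction of \<open>D0\<close> to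
  the range of the same restriction of \<open>D\<close>. The map \<open>\<iota>\<close> will be the inclusion of the \<open>p\<close>
  or the \<open>(p,s)\<close> directions.
\<close>

lemma range_restricted_derivative_transfer:
  fixes D0 :: "'a::real_vector \<Rightarrow> 'b::real_vector" and D :: "'a \<Rightarrow> 'c::real_vector"
  assumes "linear D0" "linear D" and ker: "\<And>v. D0 v = 0 \<Longrightarrow> D v = 0"
    and "range D = UNIV" "range (\<lambda>z. D0 (\<iota> z)) = UNIV"
  shows "range (\<lambda>z. D (\<iota> z)) = UNIV"
proof -
  have "y \<in> range (\<lambda>z. D (\<iota> z))" for y
  proof -
    obtain x where x: "y = D x" using assms(4) by auto
    obtain z where "D0 x = D0 (\<iota> z)" using assms(5) by (metis UNIV_I imageE)
    then have "D (x - \<iota> z) = 0" by (intro ker) (simp add: linear_diff[OF assms(1)])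
    then have "y = D (\<iota> z)" by (simp add: x linear_diff[OF assms(2)])
    then show ?thesis by blast
  qed
  then show ?thesis by blast
qed


section \<open>Determinants with almost dependent rows\<close>

lemma cmod_det_le:
  fixes M :: "complex^'m^'m"
  assumes "\<And>i j. cmod (M $ i $ j) \<le> B"
  shows "cmod (det M) \<le> fact CARD('m) * B ^ CARD('m)"
proof -
  have "cmod (det M) \<le> (\<Sum>p | p permutes (UNIV :: 'm set). B ^ CARD('m))"
    unfolding det_def
  proof (rule sum_norm_le)
    fix p :: "'m \<Rightarrow> 'm"
    have "cmod (of_int (sign p) * (\<Prod>i\<in>UNIV. M $ i $ p i)) = (\<Prod>i\<in>UNIV. cmod (M $ i $ p i))"
      by (simp add: norm_mult prod_norm sign_def)
    also have "\<dots> \<le> (\<Prod>i\<in>(UNIV::'m set). B)"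
      by (rule prod_mono) (simp add: assms)
    finally show "cmod (of_int (sign p) * (\<Prod>i\<in>UNIV. M $ i $ p i)) \<le> B ^ CARD('m)" by simp
  qed
  then show ?thesis by (simp add: card_permutations[OF refl])
qed

text \<open>
  By Cramer's rule, replacing row \<open>k\<close> by the combination of all rows with coefficients \<open>x\<close>
  multiplies the determinant by \<open>x $ k\<close>. That combination vanishes outside column \<open>l\<close>, so its
  entry there factors out and leaves a determinant with entries bounded by \<open>B\<close>.
\<close>

lemma cmod_det_le_row_combination:
  fixes M :: "complex^'m^'m" and x :: "complex^'m"
  assumes zero: "\<And>c. c \<noteq> l \<Longrightarrow> (\<Sum>r\<in>UNIV. x $ r * M $ r $ c) = 0"
    and bound: "\<And>i j. cmod (M $ i $ j) \<le> B" and "1 \<le> B"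
  shows "cmod (x $ k) * cmod (det M)
    \<le> fact CARD('m) * B ^ CARD('m) * cmod (\<Sum>r\<in>UNIV. x $ r * M $ r $ l)"
proof -
  define w where "w = (\<Sum>r\<in>UNIV. x $ r * M $ r $ l)"
  define N :: "complex^'m^'m" where "N = (\<chi> i. if i = k then axis l 1 else row i M)"
  have comb: "(\<Sum>i\<in>UNIV. x $ i *s row i M) = w *s axis l 1"
    using zero by (auto simp: vec_eq_iff row_def axis_def w_def)
  have "x $ k * det M = det (\<chi> i. if i = k then w *s axis l 1 else row i M)"
    using cramer_lemma_transpose[of k x M] unfolding comb by simp
  also have "\<dots> = w * det N"
    unfolding N_def by (rule det_row_mul)
  finally have "cmod (x $ k) * cmod (det M) = cmod w * cmod (det N)"
    by (metis norm_mult)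
  moreover have "cmod (det N) \<le> fact CARD('m) * B ^ CARD('m)"
    by (rule cmod_det_le) (use bound \<open>1 \<le> B\<close> in \<open>auto simp: N_def axis_def row_def\<close>)
  ultimately show ?thesis by (simp add: w_def[symmetric] mult.commute mult_left_mono)
qed


section \<open>The columns of the Lopatinski matrix\<close>

lemma norm_re_im_le_1:
  fixes b :: "(complex^'n) \<times> (complex^'n)"
  assumes "hermitian_prod b b = 1"
  shows "norm (((\<chi> i. Re (fst b $ i)), (\<chi> i. Re (snd b $ i))) :: (real^'n) \<times> (real^'n)) \<le> 1"
    "norm (((\<chi> i. Im (fst b $ i)), (\<chi> i. Im (snd b $ i))) :: (real^'n) \<times> (real^'n)) \<le> 1"
proof -
  have "of_real ((\<Sum>i\<in>UNIV. (cmod (fst b $ i))\<^sup>2) + (\<Sum>i\<in>UNIV. (cmod (snd b $ i))\<^sup>2)) = (1::complex)"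
    using assms unfolding hermitian_prod_def by (simp add: complex_norm_square del: of_real_power)
  then have 1: "(\<Sum>i\<in>UNIV. (cmod (fst b $ i))\<^sup>2) + (\<Sum>i\<in>UNIV. (cmod (snd b $ i))\<^sup>2) = 1"
    using of_real_eq_1_iff by blast
  have "(\<Sum>i\<in>UNIV. (Re (fst b $ i))\<^sup>2) + (\<Sum>i\<in>UNIV. (Re (snd b $ i))\<^sup>2) \<le> 1"
    "(\<Sum>i\<in>UNIV. (Im (fst b $ i))\<^sup>2) + (\<Sum>i\<in>UNIV. (Im (snd b $ i))\<^sup>2) \<le> 1"
    unfolding 1[symmetric] by (intro add_mono sum_mono; simp add: cmod_power2)+
  then show "norm (((\<chi> i. Re (fst b $ i)), (\<chi> i. Re (snd b $ i))) :: (real^'n) \<times> (real^'n)) \<le> 1"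
    "norm (((\<chi> i. Im (fst b $ i)), (\<chi> i. Im (snd b $ i))) :: (real^'n) \<times> (real^'n)) \<le> 1"
    by (simp_all add: norm_Pair norm_vec_def L2_set_def real_sqrt_le_1_iff sum_nonneg)
qed

lemma cmod_complexify_le:
  assumes "hermitian_prod b b = 1" and L: "\<And>x. norm (L x) \<le> norm x * K"
    and "K \<ge> 0"
  shows "cmod (complexify L b $ r) \<le> 2 * K"
proof -
  define u :: "(real^'a) \<times> (real^'a)" where "u = ((\<chi> i. Re (fst b $ i)), (\<chi> i. Re (snd b $ i)))"
  define w :: "(real^'a) \<times> (real^'a)" where "w = ((\<chi> i. Im (fst b $ i)), (\<chi> i. Im (snd b $ i)))"
  have "\<bar>L z $ r\<bar> \<le> K" if "norm z \<le> 1" for z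
  proof -
    have "\<bar>L z $ r\<bar> \<le> norm (L z)" by (rule component_le_norm_cart)
    also have "\<dots> \<le> norm z * K" by (rule L)
    also have "\<dots> \<le> 1 * K" using that \<open>K \<ge> 0\<close> by (intro mult_right_mono)
    finally show ?thesis by simp
  qed
  then have "\<bar>L u $ r\<bar> \<le> K" "\<bar>L w $ r\<bar> \<le> K"
    using norm_re_im_le_1[OF assms(1)] by (auto simp: u_def w_def)
  moreover have "complexify L b $ r = Complex (L u $ r) (L w $ r)"
    by (simp add: complexify_def u_def w_def split_beta)
  ultimately show ?thesis
    using cmod_le[of "complexify L b $ r"] by simp
qed

lemma inner_complexify:
  assumes "\<And>x. inner \<nu> (L x) = 0"
  shows "(\<Sum>r\<in>UNIV. of_real (\<nu> $ r) * complexify L b $ r) = 0"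
  using assms by (simp add: complexify_def split_beta complex_eq_iff inner_vec_def)

text \<open>
  The front column of the Lopatinski determinant as a function of the frequency, for scalar
  coefficients \<open>a d\<close> of \<open>i\<tau> + \<gamma>\<close> and \<open>a j\<close> of \<open>i\<eta>\<^sub>j\<close>. It serves both for the single entries of the
  column and for their combination with coefficients \<open>\<nu>\<close>.
\<close>

definition front_symbol :: "('d::finite \<Rightarrow> real) \<Rightarrow> 'd \<Rightarrow> (real^'d) \<times> real \<Rightarrow> complex" where
  "front_symbol a d = (\<lambda>(y, \<gamma>). of_real (a d) * (\<i> * of_real (y $ d) + of_real \<gamma>) +
     (\<Sum>j\<in>UNIV - {d}. of_real (a j) * \<i> * of_real (y $ j)))"

lemma front_symbol_sum:
  "(\<Sum>r\<in>UNIV. of_real (\<nu> $ r) * front_symbol (\<lambda>j. a j $ r) d \<zeta>)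
    = front_symbol (\<lambda>j. inner \<nu> (a j)) d \<zeta>"
proof -
  obtain y \<gamma> where \<zeta>: "\<zeta> = (y, \<gamma>)" by (cases \<zeta>)
  show ?thesis
    unfolding \<zeta> front_symbol_def
    by (simp add: inner_vec_def sum_distrib_left sum_distrib_right distrib_left sum.distrib
        sum.swap[of _ _ "UNIV - {d}"] mult.assoc)
qed

lemma S_plus_components:
  assumes "(y, \<gamma>) \<in> S_plus"
  shows "\<bar>y $ j\<bar> \<le> 1" "\<bar>\<gamma>\<bar> \<le> 1"
proof -
  have "norm (y, \<gamma>) = 1" using assms by (simp add: S_plus_def)
  then have "norm y \<le> 1" "norm \<gamma> \<le> 1" by (metis norm_fst_le, metis norm_snd_le)
  then show "\<bar>y $ j\<bar> \<le> 1" "\<bar>\<gamma>\<bar> \<le> 1"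
    using component_le_norm_cart[of y j] by auto
qed

lemma cmod_front_symbol_le:
  assumes "\<zeta> \<in> S_plus"
  shows "cmod (front_symbol a d \<zeta>) \<le> 2 * (\<Sum>j\<in>UNIV. \<bar>a j\<bar>)"
proof -
  obtain y \<gamma> where \<zeta>: "\<zeta> = (y, \<gamma>)" by (cases \<zeta>)
  note le = S_plus_components[OF assms[unfolded \<zeta>]]
  have "cmod (\<i> * of_real (y $ d) + of_real \<gamma>) \<le> 2"
    using le(1)[of d] le(2) by (intro norm_triangle_le) (simp add: norm_mult)
  then have "cmod (of_real (a d) * (\<i> * of_real (y $ d) + of_real \<gamma>)) \<le> \<bar>a d\<bar> * 2"
    unfolding norm_mult by (intro mult_mono) auto
  moreover have "cmod (\<Sum>j\<in>UNIV - {d}. of_real (a j) * \<i> * of_real (y $ j)) \<le> (\<Sum>j\<in>UNIV - {d}. \<bar>a j\<bar>)"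
    by (rule sum_norm_le) (use le(1) in \<open>simp add: norm_mult mult_left_le\<close>)
  moreover have "(\<Sum>j\<in>UNIV. \<bar>a j\<bar>) = \<bar>a d\<bar> + (\<Sum>j\<in>UNIV - {d}. \<bar>a j\<bar>)"
    by (rule sum.remove) auto
  moreover have "(\<Sum>j\<in>UNIV - {d}. \<bar>a j\<bar>) \<ge> 0" by (simp add: sum_nonneg)
  ultimately show ?thesis
    unfolding \<zeta> front_symbol_def prod.case by (intro norm_triangle_le) linarith
qed

lemma lopatinski_det_eq:
  "lopatinski_det d chi q \<zeta> l b = det (\<chi> r c. if c = l
     then front_symbol (\<lambda>j. deriv_sh chi q j $ r) d \<zeta>
     else complexify (deriv_p chi q) (b c) $ r)"
proof (cases \<zeta>)
  case (Pair y \<gamma>)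
  show ?thesis unfolding Pair lopatinski_det_def front_symbol_def prod.case ..
qed

lemma linear_deriv_p:
  fixes chi :: "('a::finite, 'b::finite) front_point \<Rightarrow> real^'m"
  assumes "chi differentiable (at q)"
  shows "linear (deriv_p chi q)"
proof -
  have "linear (\<lambda>v::(real^'a) \<times> (real^'a). (fst v, snd v, 0 :: real^'b))"
    by (rule linearI) auto
  from linear_compose[OF this linear_frechet_derivative[OF assms]]
  show ?thesis by (simp add: deriv_p_def o_def case_prod_unfold)
qed

lemma linear_deriv_ps:
  fixes chi :: "('a::finite, 'b::finite) front_point \<Rightarrow> real^'m"
  assumes "chi differentiable (at q)"
  shows "linear (deriv_ps d chi q)"
proof -
  have "linear (\<lambda>v::(real^'a) \<times> (real^'a) \<times> real. (fst v, fst (snd v), axis d (snd (snd v))))"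
    by (rule linearI) (auto simp: vec_eq_iff axis_def)
  from linear_compose[OF this linear_frechet_derivative[OF assms]]
  show ?thesis by (simp add: deriv_ps_def o_def case_prod_unfold)
qed

lemma deriv_ps_eq:
  assumes "chi differentiable (at q)"
  shows "deriv_ps d chi q (vp, vm, t) = deriv_p chi q (vp, vm) + t *\<^sub>R deriv_sh chi q d"
proof -
  have lin: "linear (frechet_derivative chi (at q))"
    by (rule linear_frechet_derivative[OF assms])
  have "(vp, vm, axis d t) = (vp, vm, 0) + t *\<^sub>R (0, 0, axis d 1)"
    by (simp add: vec_eq_iff axis_def)
  then show ?thesis
    by (simp only: deriv_ps_def deriv_p_def deriv_sh_def prod.case linear_add[OF lin] linear_cmul[OF lin])
qed


section \<open>Consequences of the uniform Lopatinski condition\<close>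

text \<open>
  The constant \<open>K\<close> is uniform in the frequency, although the space \<open>E\<close> varies with it, because
  basis vectors of norm one give columns bounded by the norm of the derivative alone.
\<close>

lemma lopatinski_det_bound:
  fixes chi :: "('n::finite, 'd::finite) front_point \<Rightarrow> real^'m" and \<nu> :: "real^'m"
  assumes "chi differentiable (at q)" and "\<nu> \<noteq> 0"
    and orth: "\<And>x. inner \<nu> (deriv_p chi q x) = 0"
  obtains K where "\<And>\<zeta> l b E. \<zeta> \<in> S_plus \<Longrightarrow> orthonormal_basis_on (UNIV - {l}) b E \<Longrightarrow>
    cmod (lopatinski_det d chi q \<zeta> l b)
      \<le> K * cmod (front_symbol (\<lambda>j. inner \<nu> (deriv_sh chi q j)) d \<zeta>)"
proof -
  obtain k where k: "\<nu> $ k \<noteq> 0" using \<open>\<nu> \<noteq> 0\<close> by (auto simp: vec_eq_iff)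
  obtain Kp where Kp: "Kp > 0" "\<And>x. norm (deriv_p chi q x) \<le> norm x * Kp"
    using linear_deriv_p[OF assms(1)] bounded_linear.pos_bounded
    by (metis linear_conv_bounded_linear)
  define Kf where "Kf = (\<Sum>r\<in>UNIV. \<Sum>j\<in>UNIV. \<bar>deriv_sh chi q j $ r\<bar>)"
  define B where "B = 1 + 2 * Kp + 2 * Kf"
  have "Kf \<ge> 0" by (simp add: Kf_def sum_nonneg)
  have Kf: "(\<Sum>j\<in>UNIV. \<bar>deriv_sh chi q j $ r\<bar>) \<le> Kf" for r
    unfolding Kf_def by (rule member_le_sum) (auto simp: sum_nonneg)
  show ?thesis
  proof (rule that)
    fix \<zeta> :: "(real^'d) \<times> real" and l :: 'm and b and E :: "((complex^'n) \<times> (complex^'n)) set"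
    assume \<zeta>: "\<zeta> \<in> S_plus" and b: "orthonormal_basis_on (UNIV - {l}) b E"
    define M where "M = (\<chi> r c. if c = l
      then front_symbol (\<lambda>j. deriv_sh chi q j $ r) d \<zeta>
      else complexify (deriv_p chi q) (b c) $ r)"
    define x :: "complex^'m" where "x = (\<chi> r. of_real (\<nu> $ r))"
    have "cmod (M $ r $ c) \<le> B" for r c
    proof (cases "c = l")
      case True
      have "cmod (M $ r $ c) \<le> 2 * (\<Sum>j\<in>UNIV. \<bar>deriv_sh chi q j $ r\<bar>)"
        using True cmod_front_symbol_le[OF \<zeta>] by (simp add: M_def)
      then show ?thesis using Kf[of r] Kp(1) by (simp add: B_def)
    next
      case False
      then have "hermitian_prod (b c) (b c) = 1"
        using b by (simp add: orthonormal_basis_on_def)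
      from cmod_complexify_le[OF this Kp(2)] False Kp(1) \<open>Kf \<ge> 0\<close> show ?thesis
        by (simp add: M_def B_def add_increasing add_increasing2)
    qed
    moreover have "(\<Sum>r\<in>UNIV. x $ r * M $ r $ c) = 0" if "c \<noteq> l" for c
      using that inner_complexify[OF orth] by (simp add: x_def M_def)
    moreover have "1 \<le> B" using Kp(1) \<open>Kf \<ge> 0\<close> by (simp add: B_def)
    ultimately have "cmod (x $ k) * cmod (det M)
        \<le> fact CARD('m) * B ^ CARD('m) * cmod (\<Sum>r\<in>UNIV. x $ r * M $ r $ l)"
      by (intro cmod_det_le_row_combination)
    also have "(\<Sum>r\<in>UNIV. x $ r * M $ r $ l) = front_symbol (\<lambda>j. inner \<nu> (deriv_sh chi q j)) d \<zeta>"
      by (simp add: x_def M_def front_symbol_sum)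
    finally show "cmod (lopatinski_det d chi q \<zeta> l b)
      \<le> (fact CARD('m) * B ^ CARD('m) / \<bar>\<nu> $ k\<bar>)
        * cmod (front_symbol (\<lambda>j. inner \<nu> (deriv_sh chi q j)) d \<zeta>)"
      using k by (simp add: x_def M_def lopatinski_det_eq field_simps)
  qed
qed

lemma uniform_lopatinski_front_symbol_lower_bound:
  fixes chi :: "('n::finite, 'd::finite) front_point \<Rightarrow> real^'m" and \<nu> :: "real^'m"
  assumes "uniform_lopatinski A0 A d chi q" and "chi differentiable (at q)" and "\<nu> \<noteq> 0"
    and "\<And>x. inner \<nu> (deriv_p chi q x) = 0"
  obtains c where "c > 0" "\<And>\<zeta>. \<zeta> \<in> S_plus \<Longrightarrow>
    c \<le> cmod (front_symbol (\<lambda>j. inner \<nu> (deriv_sh chi q j)) d \<zeta>)"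
proof -
  obtain K where K: "\<And>\<zeta> l b E. \<zeta> \<in> S_plus \<Longrightarrow> orthonormal_basis_on (UNIV - {l}) b E \<Longrightarrow>
    cmod (lopatinski_det d chi q \<zeta> l b)
      \<le> K * cmod (front_symbol (\<lambda>j. inner \<nu> (deriv_sh chi q j)) d \<zeta>)"
    using lopatinski_det_bound[OF assms(2-4)] by blast
  obtain c where c: "c > 0" "\<And>\<zeta>. \<zeta> \<in> S_plus \<Longrightarrow> \<exists>l b.
        orthonormal_basis_on (UNIV - {l}) b (E_minus_H0 A0 A d q \<zeta>) \<and>
        cmod (lopatinski_det d chi q \<zeta> l b) \<ge> c"
    using assms(1) unfolding uniform_lopatinski_def by blast
  have low: "c \<le> K * cmod (front_symbol (\<lambda>j. inner \<nu> (deriv_sh chi q j)) d \<zeta>)"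
    if "\<zeta> \<in> S_plus" for \<zeta>
    using K[OF that] c(2)[OF that] by (meson order_trans)
  show ?thesis
  proof (rule that)
    show "c / (\<bar>K\<bar> + 1) > 0" using c(1) by (simp add: add_nonneg_pos)
    fix \<zeta> :: "(real^'d) \<times> real" assume "\<zeta> \<in> S_plus"
    note low[OF this]
    also have "K * cmod (front_symbol (\<lambda>j. inner \<nu> (deriv_sh chi q j)) d \<zeta>)
      \<le> (\<bar>K\<bar> + 1) * cmod (front_symbol (\<lambda>j. inner \<nu> (deriv_sh chi q j)) d \<zeta>)"
      by (intro mult_right_mono) auto
    finally show "c / (\<bar>K\<bar> + 1) \<le> cmod (front_symbol (\<lambda>j. inner \<nu> (deriv_sh chi q j)) d \<zeta>)"
      by (simp add: pos_divide_le_eq mult.commute add_nonneg_pos)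
  qed
qed

text \<open>
  The symbol vanishes at a frequency with \<open>\<gamma> = 0\<close>, where one component of \<open>\<eta>\<close> is \<open>1\<close> and
  \<open>\<tau> = - a j / a d\<close> cancels its contribution; the witness lies slightly above it. The value
  of \<open>\<gamma>\<close> makes the symbol \<open>c / 2\<close> in modulus before normalization, which can only decrease it
  because that component of \<open>\<eta>\<close> gives the vector norm at least \<open>1\<close>.
\<close>

lemma front_symbol_not_bounded_below:
  fixes a :: "'d::finite \<Rightarrow> real"
  assumes "CARD('d) \<ge> 2" and "a d \<noteq> 0" and "c > 0"
  shows "\<exists>\<zeta>\<in>S_plus. cmod (front_symbol a d \<zeta>) < c"
proof -
  obtain j where j: "j \<noteq> d"
    using assms(1) by (metis card_2_iff' ex_card UNIV_I insertE singletonD subset_UNIV)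
  define y :: "real^'d" where "y = (\<chi> i. if i = d then - a j / a d else if i = j then 1 else 0)"
  define \<gamma> where "\<gamma> = c / (2 * \<bar>a d\<bar>)"
  have \<gamma>: "\<gamma> > 0" using assms by (simp add: \<gamma>_def)
  define e where "e = norm (y, \<gamma>)"
  have "1 \<le> e"
  proof -
    have "1 = \<bar>y $ j\<bar>" using j by (simp add: y_def)
    also have "\<dots> \<le> norm y" by (rule component_le_norm_cart)
    also have "\<dots> \<le> e" unfolding e_def using norm_fst_le[of y \<gamma>] by simp
    finally show ?thesis .
  qed
  have "(y /\<^sub>R e, \<gamma> / e) = (y, \<gamma>) /\<^sub>R e" by (simp add: divide_inverse mult.commute)
  then have "norm (y /\<^sub>R e, \<gamma> / e) = 1"
    using \<open>1 \<le> e\<close> by (simp add: e_def[symmetric] del: scaleR_Pair)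
  then have "(y /\<^sub>R e, \<gamma> / e) \<in> S_plus" using \<gamma> \<open>1 \<le> e\<close> by (simp add: S_plus_def)
  moreover have "front_symbol a d (y /\<^sub>R e, \<gamma> / e) = of_real (a d * \<gamma> / e)"
  proof -
    have "(\<Sum>i\<in>UNIV - {d}. complex_of_real (a i) * \<i> * of_real ((y /\<^sub>R e) $ i))
        = (\<Sum>i\<in>UNIV - {d}. if i = j then of_real (a j) * \<i> / of_real e else 0)"
      by (rule sum.cong) (auto simp: y_def divide_inverse)
    also have "\<dots> = of_real (a j) * \<i> / of_real e" using j by simp
    finally show ?thesis
      using assms(2) \<open>1 \<le> e\<close> by (simp add: front_symbol_def y_def field_simps)
  qed
  moreover have "\<bar>a d * \<gamma> / e\<bar> < c"
  proof -
    have "\<bar>a d * \<gamma> / e\<bar> = c / 2 / e" using assms \<open>1 \<le> e\<close> by (simp add: \<gamma>_def abs_mult)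
    also have "\<dots> \<le> c / 2" using assms(3) \<open>1 \<le> e\<close> by (simp add: divide_le_eq)
    also have "\<dots> < c" using assms(3) by simp
    finally show ?thesis .
  qed
  ultimately show ?thesis by (metis norm_of_real)
qed


section \<open>Surjectivity of the partial derivatives\<close>

lemma linear_range_eq_UNIV_if_no_conormal:
  fixes f :: "'a::real_vector \<Rightarrow> 'b::euclidean_space"
  assumes "linear f" and "\<And>\<nu>. \<nu> \<noteq> 0 \<Longrightarrow> \<exists>x. inner \<nu> (f x) \<noteq> 0"
  shows "range f = UNIV"
proof (rule ccontr)
  assume "range f \<noteq> UNIV"
  moreover have sub: "subspace (range f)" using assms(1) by (simp add: linear_subspace_image)
  ultimately have "dim (range f) < DIM('b)"
    by (metis dim_eq_full dim_subset_UNIV le_neq_implies_less span_eq_iff)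
  then obtain \<nu> where "\<nu> \<noteq> 0" "\<And>y. y \<in> span (range f) \<Longrightarrow> orthogonal \<nu> y"
    using orthogonal_to_subspace_exists by metis
  then show False using assms(2)[of \<nu>] by (auto simp: orthogonal_def span_base)
qed

lemma uniform_lopatinski_deriv_ps_surj:
  assumes "uniform_lopatinski A0 A d chi q" and diff: "chi differentiable (at q)"
  shows "range (deriv_ps d chi q) = UNIV"
proof (rule linear_range_eq_UNIV_if_no_conormal[OF linear_deriv_ps[OF diff]], rule ccontr)
  fix \<nu> :: "real^'c"
  assume "\<nu> \<noteq> 0" and "\<not> (\<exists>x. inner \<nu> (deriv_ps d chi q x) \<noteq> 0)"
  then have zero: "inner \<nu> (deriv_ps d chi q x) = 0" for x by blast
  have orth: "inner \<nu> (deriv_p chi q x) = 0" for x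
    using zero[of "(fst x, snd x, 0)"] by (simp add: deriv_ps_eq[OF diff])
  have s: "inner \<nu> (deriv_sh chi q d) = 0"
    using zero[of "(0, 0, 1)"] orth[of "(0, 0)"] by (simp add: deriv_ps_eq[OF diff] inner_add_right)
  obtain c where c: "c > 0" "\<And>\<zeta>. \<zeta> \<in> S_plus \<Longrightarrow>
    c \<le> cmod (front_symbol (\<lambda>j. inner \<nu> (deriv_sh chi q j)) d \<zeta>)"
    using uniform_lopatinski_front_symbol_lower_bound[OF assms \<open>\<nu> \<noteq> 0\<close> orth] by metis
  \<comment> \<open>At this frequency the front column is \<open>\<chi>'\<^sub>s\<close> itself.\<close>
  have "(0, 1) \<in> S_plus" by (simp add: S_plus_def norm_Pair)
  from c(2)[OF this] c(1) show False by (simp add: front_symbol_def s)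
qed

lemma uniform_lopatinski_deriv_p_surj:
  fixes chi :: "('n::finite, 'd::finite) front_point \<Rightarrow> real^'m"
  assumes "uniform_lopatinski A0 A d chi q" and diff: "chi differentiable (at q)"
    and "CARD('d) \<ge> 2"
  shows "range (deriv_p chi q) = UNIV"
proof (rule linear_range_eq_UNIV_if_no_conormal[OF linear_deriv_p[OF diff]], rule ccontr)
  fix \<nu> :: "real^'m"
  assume "\<nu> \<noteq> 0" and "\<not> (\<exists>x. inner \<nu> (deriv_p chi q x) \<noteq> 0)"
  then have orth: "inner \<nu> (deriv_p chi q x) = 0" for x by blast
  have "inner \<nu> (deriv_sh chi q d) \<noteq> 0"
  proof
    assume "inner \<nu> (deriv_sh chi q d) = 0"
    then have "inner \<nu> (deriv_ps d chi q x) = 0" for x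
      by (cases x) (simp add: deriv_ps_eq[OF diff] inner_add_right orth)
    moreover obtain x where "deriv_ps d chi q x = \<nu>"
      using uniform_lopatinski_deriv_ps_surj[OF assms(1,2)] by (metis rangeE UNIV_I)
    ultimately show False using \<open>\<nu> \<noteq> 0\<close> by (metis inner_eq_zero_iff)
  qed
  moreover obtain c where "c > 0" "\<And>\<zeta>. \<zeta> \<in> S_plus \<Longrightarrow>
    c \<le> cmod (front_symbol (\<lambda>j. inner \<nu> (deriv_sh chi q j)) d \<zeta>)"
    using uniform_lopatinski_front_symbol_lower_bound[OF assms(1,2) \<open>\<nu> \<noteq> 0\<close> orth] by metis
  ultimately show False
    using front_symbol_not_bounded_below[OF assms(3), of "\<lambda>j. inner \<nu> (deriv_sh chi q j)" d c]
    by (meson not_less)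
qed


section \<open>Rank of the partial derivatives of a defining function\<close>

theorem proposition1p18:
  fixes A0 :: "real^'n \<Rightarrow> real^'n^'n"
    and A :: "'d::finite \<Rightarrow> real^'n \<Rightarrow> real^'n^'n"
    and d :: 'd
    and k :: nat
    and C :: "('n::finite, 'd::finite) front_point set"
    and q :: "('n::finite, 'd::finite) front_point"
    and chi0 chi :: "('n::finite, 'd::finite) front_point \<Rightarrow> real^'m"
  assumes "hyperbolic_system Us Up Um A0 A"
    and "shock_manifold A0 A d Up Um k C"
    and "q \<in> C"
    and "CARD('m) = CARD('n) + k"
    and "local_defining_function C q chi0"
    and "uniform_lopatinski A0 A d chi0 q"
    and "local_defining_function C q chi"
  shows "dim (range (deriv_ps d chi q)) = CARD('n) + k \<and>
    (CARD('d) \<ge> 2 \<longrightarrow> dim (range (deriv_p chi q)) = CARD('n) + k)"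
proof -
  have diff: "chi0 differentiable (at q)" "chi differentiable (at q)"
    using assms(5,7) smooth_on_imp_differentiable unfolding local_defining_function_def by blast+
  note transfer = range_restricted_derivative_transfer
    [OF linear_frechet_derivative[OF diff(1)] linear_frechet_derivative[OF diff(2)]
      kernel_of_local_defining_function_unique[OF assms(5,7,3)]
      range_frechet_derivative_eq_UNIV[OF assms(7)]]
  have "range (deriv_ps d chi q) = UNIV"
    using transfer[of "\<lambda>(vp, vm, t). (vp, vm, axis d t)"]
      uniform_lopatinski_deriv_ps_surj[OF assms(6) diff(1)]
    by (simp add: deriv_ps_def split_beta)
  moreover have "range (deriv_p chi q) = UNIV" if "CARD('d) \<ge> 2"
    using transfer[of "\<lambda>(vp, vm). (vp, vm, 0)"]
      uniform_lopatinski_deriv_p_surj[OF assms(6) diff(1) that]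
    by (simp add: deriv_p_def split_beta)
  ultimately show ?thesis using assms(4) by (simp add: dim_UNIV)
qed

end
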